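(* Write $\bar a=1/a$. Let $W\equiv W(x;a)$ be the unique formal power series in $x$ such that $$W=x\bar a(1+a)(W+1+a)(W+a).$$ Let $S(y,z)\equiv S(x;y,z)$ be the formal power series in $x$ (with coefficients polynomial in $y,z$) that solves $$S(y,z)=xyz+\frac{xyz}{1-y}\bigl(S(1,z)-S(y,z)\bigr)+\frac{xyz}{z-y}\bigl(S(y,z)-S(y,y)\bigr).$$ Then $$S(1+a,1+a)=\Omega_{\geq}\left[F(a,W)\right],$$ where $$\begin{aligned}F(a,W)={}&(1+a)^2\,x+\left(\bar a^5+\bar a^4+2+2a\right)x\,W\\&+\left(-\bar a^5-\bar a^4+\bar a^3-\bar a^2-\bar a+1\right)x\,W^2+\left(\bar a^4-\bar a^2\right)x\,W^3.\end{aligned}$$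
   Context: For a formal power series $F(x;a)=\sum_{n\geq 0,\,i\in\mathbb{Z}}f(n,i)\,a^ix^n$ in $x$ whose coefficients are Laurent polynomials in $a$, $\Omega_{\geq}[F(x;a)]=\sum_{n\geq 0}x^n\sum_{i\geq 0}f(n,i)\,a^i$ denotes its non-negative part in $a$. The dependence on $x$ is left implicit in the notation $S(y,z)$ and $F(a,W)$. The series $S(y,z)$ is the generating function of semi-Baxter permutations (permutations $\pi$ with no indices $i<j$ and $k>j+1$ such that $\pi_{j+1}<\pi_i<\pi_k<\pi_j$), where $x$ marks the size and $y$ and $z$ mark two further statistics; in particular $S(1,1)=\sum_{n\geq 1}SB_n\,x^n$ where $SB_n$ is the number of semi-Baxter permutations of size $n$. *)

theory Defs
  imports
    "HOL-Library.Poly_Mapping"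
    "HOL-Computational_Algebra.Computational_Algebra"
begin

text \<open>
  The Laurent polynomials in \<open>a\<close> over the rationals are the group algebra of the integers,
  i.e. finitely supported functions \<open>int \<Rightarrow> rat\<close> with the convolution product.
\<close>

type_synonym laurent = "int \<Rightarrow>\<^sub>0 rat"

definition a_var :: laurent where
  "a_var = Poly_Mapping.single 1 1"

definition a_bar :: laurent where
  "a_bar = Poly_Mapping.single (- 1) 1"

lemma a_bar_a_var: "a_bar * a_var = 1"
  by (simp add: a_bar_def a_var_def mult_single)

definition nonneg_part :: "laurent \<Rightarrow> laurent" where
  "nonneg_part f = (\<Sum>i \<in> {i \<in> Poly_Mapping.keys f. i \<ge> 0}.
     Poly_Mapping.single i (Poly_Mapping.lookup f i))"

lemma lookup_nonneg_part:
  "Poly_Mapping.lookup (nonneg_part f) i = (if i \<ge> 0 then Poly_Mapping.lookup f i else 0)"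
  by (auto simp: nonneg_part_def lookup_sum lookup_single when_def in_keys_iff)

definition Omega_ge :: "laurent fps \<Rightarrow> laurent fps" where
  "Omega_ge F = Abs_fps (\<lambda>n. nonneg_part (fps_nth F n))"

definition W_equation :: "laurent fps \<Rightarrow> bool" where
  "W_equation W \<longleftrightarrow>
     (let a = fps_const a_var; a' = fps_const a_bar
      in W = fps_X * a' * (1 + a) * (W + 1 + a) * (W + a))"

definition F_series :: "laurent fps \<Rightarrow> laurent fps" where
  "F_series W =
     (let a = fps_const a_var; a' = fps_const a_bar; x = fps_X
      in (1 + a)^2 * x
         + (a'^5 + a'^4 + 2 + 2 * a) * x * W
         + (- (a'^5) - a'^4 + a'^3 - a'^2 - a' + 1) * x * W^2
         + (a'^4 - a'^2) * x * W^3)"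

text \<open>
  A polynomial in \<open>y, z\<close> is represented as a polynomial in \<open>z\<close> (outer variable) whose
  coefficients are polynomials in \<open>y\<close> (inner variable).  It is evaluated at \<open>y = u\<close>,
  \<open>z = v\<close> in a ring into which the rationals are mapped by \<open>h\<close>.
\<close>

definition eval2 ::
  "(rat \<Rightarrow> 'r) \<Rightarrow> 'r \<Rightarrow> 'r \<Rightarrow> rat poly poly \<Rightarrow> 'r :: comm_ring_1" where
  "eval2 h u v p =
     (\<Sum>j \<le> degree p. \<Sum>i \<le> degree (coeff p j). h (coeff (coeff p j) i) * u^i * v^j)"

definition fps_eval2 ::
  "(rat \<Rightarrow> 'r) \<Rightarrow> rat poly poly fps \<Rightarrow> 'r \<Rightarrow> 'r \<Rightarrow> 'r :: comm_ring_1 fps" where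
  "fps_eval2 h S u v = Abs_fps (\<lambda>n. eval2 h u v (fps_nth S n))"

text \<open>
  The denominators \<open>1 - y\<close> and \<open>z - y\<close> in the equation for \<open>S\<close> make sense in the field of
  rational functions in \<open>y, z\<close>, so the equation is an identity of power series in \<open>x\<close> over
  that field.
\<close>

type_synonym ratfun2 = "rat poly poly fract"

definition y_var :: ratfun2 where
  "y_var = to_fract [:[:0, 1:]:]"

definition z_var :: ratfun2 where
  "z_var = to_fract [:0, 1:]"

definition ratfun2_const :: "rat \<Rightarrow> ratfun2" where
  "ratfun2_const c = to_fract [:[:c:]:]"

lemma eval2_generic: "eval2 ratfun2_const y_var z_var p = to_fract p"
proof -
  have pow: "to_fract q ^ n = to_fract (q ^ n)" for q :: "rat poly poly" and n
    by (induction n) auto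
  have sum: "to_fract (sum f A) = (\<Sum>i\<in>A. to_fract (f i))"
    for f :: "nat \<Rightarrow> rat poly poly" and A
    by (induction A rule: infinite_finite_induct) auto
  have lift: "[:sum f A:] = (\<Sum>i\<in>A. [:f i:])" for f :: "nat \<Rightarrow> rat poly" and A
    by (rule poly_eqI) (auto simp: coeff_sum coeff_pCons split: nat.split)
  have "[:[:c:]:] * [:[:0, 1:]:] ^ i = [:monom c i:]" for c :: rat and i
    by (simp add: poly_const_pow monom_altdef)
  hence inner: "(\<Sum>i \<le> degree q. [:[:coeff q i:]:] * [:[:0, 1:]:] ^ i) = [:q:]" for q :: "rat poly"
    by (simp flip: lift add: poly_as_sum_of_monoms)
  have "(\<Sum>j \<le> degree p. \<Sum>i \<le> degree (coeff p j).
            [:[:coeff (coeff p j) i:]:] * [:[:0, 1:]:] ^ i * [:0, 1:] ^ j) =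
         (\<Sum>j \<le> degree p. [:coeff p j:] * [:0, 1:] ^ j)"
    by (simp only: inner flip: sum_distrib_right)
  also have "\<dots> = (\<Sum>j \<le> degree p. monom (coeff p j) j)"
    by (simp add: monom_altdef)
  also have "\<dots> = p"
    by (rule poly_as_sum_of_monoms)
  finally have "to_fract (\<Sum>j \<le> degree p. \<Sum>i \<le> degree (coeff p j).
            [:[:coeff (coeff p j) i:]:] * [:[:0, 1:]:] ^ i * [:0, 1:] ^ j) = to_fract p"
    by (rule arg_cong)
  thus ?thesis
    by (simp add: eval2_def ratfun2_const_def y_var_def z_var_def pow sum flip: to_fract_mult)
qed

definition S_equation :: "rat poly poly fps \<Rightarrow> bool" where
  "S_equation S \<longleftrightarrow>
     (let x = fps_X; y = y_var; z = z_var; S' = fps_eval2 ratfun2_const S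
      in S' y z = x * fps_const (y * z)
           + x * fps_const (y * z / (1 - y)) * (S' 1 z - S' y z)
           + x * fps_const (y * z / (z - y)) * (S' y z - S' y y))"

definition laurent_const :: "rat \<Rightarrow> laurent" where
  "laurent_const c = Poly_Mapping.single 0 c"

end

theory Submission
  imports Defs
begin

text \<open>
  Write \<open>b = 1 / a\<close>, \<open>R u = S(u, u)\<close> and \<open>T v = S(1, v)\<close>.  Collecting the terms with \<open>S(u, v)\<close> in
  the functional equation gives a kernel whose vanishing, for power series \<open>u, v\<close> in \<open>x\<close>, means
  \<open>(u - 1) (v - u) = x u v (v - 1)\<close>; in that case \<open>S(u, v)\<close> itself drops out and
  \<open>(u - 1) (v - u) = (v - u) T v + (u - 1) R u\<close> remains (\<open>S_at_kernel_zero\<close>).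

  The equation of \<open>W\<close> says that the kernel vanishes at \<open>u = 1 + a\<close>, \<open>v = 1 + a + W\<close>.  The kernel
  equation is quadratic in \<open>u\<close> for fixed \<open>v\<close> and in \<open>v\<close> for fixed \<open>u\<close>, and exchanging the two roots
  alternately in \<open>u\<close> and in \<open>v\<close> leads from this pair through
  \[ (1 + a, z), \quad (1 + V, z), \quad (1 + V, 1 + b W), \quad (1 + U, 1 + b W), \quad (1 + U, 1 + b), \]
  where \<open>z = 1 + a + W\<close>, \<open>V = W / (1 + a)\<close> and \<open>U = W / (a z)\<close>.  Because of the equation of \<open>W\<close>
  both \<open>V\<close> and \<open>U\<close> are power series in \<open>x\<close> with Laurent polynomial coefficients, so all five pairs
  may be substituted into \<open>S\<close> (\<open>kernel_orbit\<close>).  Neighbouring pairs share a coordinate, so the five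
  relations can be solved for \<open>R (1 + a)\<close> in terms of the last unknown, \<open>T (1 + b)\<close>.  All occurrences
  of \<open>W\<close> in the coefficient of \<open>T (1 + b)\<close> cancel, and what results is the exact identity
  \[ S(1 + a, 1 + a) = F(a, W) - x (1 + a)^2 b^4 S(1, 1 + b) \]
  (\<open>orbit_elimination\<close>, \<open>S_at_1_plus_a\<close>).  Its left-hand side contains no negative power of \<open>a\<close>, and
  the last term contains only negative ones, so the non-negative part of \<open>F(a, W)\<close> is the left-hand
  side.  Existence and uniqueness of \<open>W\<close> and \<open>S\<close> hold because both equations determine the
  coefficient of \<open>x^n\<close> from those of lower order.
\<close>

section \<open>Fixed points of contractions on power series\<close>

text \<open>
  The iterates of \<open>\<Phi>\<close> on \<open>0\<close> become stationary coefficient by coefficient; the fixed point collects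
  the stationary values.
\<close>

lemma fps_contraction_fixpoint:
  fixes \<Phi> :: "'a::zero fps \<Rightarrow> 'a fps"
  assumes contr: "\<And>f g n. (\<And>i. i < n \<Longrightarrow> fps_nth f i = fps_nth g i) \<Longrightarrow>
    fps_nth (\<Phi> f) n = fps_nth (\<Phi> g) n"
  shows "\<exists>!f. f = \<Phi> f"
proof (rule ex_ex1I)
  define it where "it k = (\<Phi> ^^ k) 0" for k
  have it_Suc: "it (Suc k) = \<Phi> (it k)" for k
    by (simp add: it_def)
  have stable: "fps_nth (it (Suc n + d)) n = fps_nth (it (Suc n)) n" for n d
  proof (induction n arbitrary: d rule: less_induct)
    case (less n)
    have "fps_nth (it (n + d)) i = fps_nth (it n) i" if "i < n" for i
    proof -
      from that obtain e where "n = Suc i + e"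
        using less_imp_Suc_add by (metis add_Suc)
      then show ?thesis
        using less.IH[OF that, of "e + d"] less.IH[OF that, of e] by (simp add: add.assoc)
    qed
    then show ?case
      using contr[of n "it (n + d)" "it n"] by (simp add: it_Suc)
  qed
  define f where "f = Abs_fps (\<lambda>n. fps_nth (it (Suc n)) n)"
  have "fps_nth f n = fps_nth (\<Phi> f) n" for n
  proof -
    have "fps_nth f i = fps_nth (it n) i" if "i < n" for i
    proof -
      from that obtain e where "n = Suc i + e"
        using less_imp_Suc_add by (metis add_Suc)
      then show ?thesis
        using stable[of i e] by (simp add: f_def)
    qed
    then show ?thesis
      using contr[of n f "it n"] by (simp add: f_def it_Suc)
  qed
  then show "\<exists>f. f = \<Phi> f"
    using fps_ext by blast
next
  fix f g assume fg: "f = \<Phi> f" "g = \<Phi> g"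
  have "fps_nth f n = fps_nth g n" for n
  proof (induction n rule: less_induct)
    case (less n)
    then show ?case
      using contr[of n f g] fg by auto
  qed
  then show "f = g"
    by (rule fps_ext)
qed

section \<open>Evaluation of polynomials in two variables\<close>

locale rat_hom =
  fixes h :: "rat \<Rightarrow> 'r::comm_ring_1"
  assumes h_0: "h 0 = 0" and h_1: "h 1 = 1"
    and h_add: "h (c + d) = h c + h d" and h_mult: "h (c * d) = h c * h d"
begin

definition eval1 :: "'r \<Rightarrow> rat poly \<Rightarrow> 'r" where
  "eval1 u q = poly (map_poly h q) u"

lemma eval1_0 [simp]: "eval1 u 0 = 0"
  by (simp add: eval1_def)

lemma eval1_pCons [simp]: "eval1 u (pCons c q) = h c + u * eval1 u q"
  by (simp add: eval1_def map_poly_pCons h_0)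

lemma eval1_altdef: "eval1 u q = (\<Sum>i\<le>degree q. h (coeff q i) * u ^ i)"
proof (induction q)
  case (pCons c q)
  show ?case
  proof (cases "q = 0")
    case False
    then have "(\<Sum>i\<le>degree (pCons c q). h (coeff (pCons c q) i) * u ^ i)
        = h c + (\<Sum>i\<le>degree q. h (coeff q i) * u ^ Suc i)"
      by (simp add: sum.atMost_Suc_shift del: sum.atMost_Suc)
    then show ?thesis
      using pCons by (simp add: sum_distrib_left mult_ac)
  qed (simp add: h_0)
qed (simp add: h_0)

lemma eval1_1 [simp]: "eval1 u 1 = 1"
  by (simp add: one_pCons h_1)

lemma eval2_0 [simp]: "eval2 h u v 0 = 0"
  by (simp add: eval2_def h_0)

lemma eval2_pCons [simp]: "eval2 h u v (pCons q p) = eval1 u q + v * eval2 h u v p"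
proof -
  have eq: "eval2 h u v r = (\<Sum>j\<le>degree r. eval1 u (coeff r j) * v ^ j)" for r
    by (simp add: eval2_def eval1_altdef sum_distrib_right)
  show ?thesis
  proof (cases "p = 0")
    case False
    then have "eval2 h u v (pCons q p)
        = eval1 u q + (\<Sum>j\<le>degree p. eval1 u (coeff p j) * v ^ Suc j)"
      unfolding eq by (simp add: sum.atMost_Suc_shift del: sum.atMost_Suc)
    then show ?thesis
      by (simp add: eq[of p] sum_distrib_left mult_ac)
  qed (simp add: eq)
qed

lemma eval1_add [simp]: "eval1 u (p + q) = eval1 u p + eval1 u q"
  by (induction p q rule: poly_induct2) (simp_all add: h_add algebra_simps)

lemma eval1_smult [simp]: "eval1 u (smult c q) = h c * eval1 u q"
  by (induction q) (simp_all add: h_mult algebra_simps)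

lemma eval1_mult [simp]: "eval1 u (p * q) = eval1 u p * eval1 u q"
  by (induction p) (simp_all add: h_0 algebra_simps)

lemma eval2_add [simp]: "eval2 h u v (p + q) = eval2 h u v p + eval2 h u v q"
  by (induction p q rule: poly_induct2) (simp_all add: algebra_simps)

lemma eval2_smult [simp]: "eval2 h u v (smult c q) = eval1 u c * eval2 h u v q"
  by (induction q) (simp_all add: algebra_simps)

lemma eval2_mult [simp]: "eval2 h u v (p * q) = eval2 h u v p * eval2 h u v q"
  by (induction p) (simp_all add: algebra_simps)

lemma eval2_1 [simp]: "eval2 h u v 1 = 1"
  by (subst one_pCons) simp

lemma eval2_diff [simp]: "eval2 h u v (p - q) = eval2 h u v p - eval2 h u v q"
  using eval2_add[of u v "p - q" q] by (simp add: algebra_simps)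

end

section \<open>The functional equation as a recurrence for polynomials\<close>

definition Ypoly :: "rat poly poly" where
  "Ypoly = [:[:0, 1:]:]"

definition Zpoly :: "rat poly poly" where
  "Zpoly = [:0, 1:]"

definition y_to_1 :: "rat poly poly \<Rightarrow> rat poly poly" where
  "y_to_1 p = map_poly (\<lambda>q. [:poly q 1:]) p"

definition z_to_y :: "rat poly poly \<Rightarrow> rat poly poly" where
  "z_to_y p = [:poly p [:0, 1:]:]"

context rat_hom
begin

lemma eval2_Ypoly [simp]: "eval2 h u v Ypoly = u"
  by (simp add: Ypoly_def h_0 h_1)

lemma eval2_Zpoly [simp]: "eval2 h u v Zpoly = v"
  by (simp add: Zpoly_def)

lemma eval2_y_to_1: "eval2 h u v (y_to_1 p) = eval2 h 1 v p"
proof (induction p)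
  case (pCons q p)
  have "h (poly q 1) = eval1 1 q"
    by (induction q) (simp_all add: h_0 h_add)
  with pCons show ?case
    by (simp add: y_to_1_def map_poly_pCons)
qed (simp add: y_to_1_def)

lemma eval2_z_to_y: "eval2 h u v (z_to_y p) = eval2 h u u p"
  by (induction p) (simp_all add: z_to_y_def h_0 h_1)

end

lemma dvd_y_to_1: "(1 - Ypoly) dvd (y_to_1 p - p)"
proof -
  have "[:1, - 1:] dvd [:poly q 1:] - q" for q :: "rat poly"
  proof -
    have "[:- 1, 1:] dvd [:poly q 1:] - q"
      by (simp add: poly_eq_0_iff_dvd[symmetric])
    then show ?thesis
      using minus_dvd_iff[of "[:- 1, 1:]" "[:poly q 1:] - q"] by simp
  qed
  then have "[:[:1, - 1:]:] dvd y_to_1 p - p"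
    by (simp add: const_poly_dvd_iff y_to_1_def coeff_map_poly)
  then show ?thesis
    by (simp add: Ypoly_def one_pCons)
qed

lemma dvd_z_to_y: "(Zpoly - Ypoly) dvd (p - z_to_y p)"
proof -
  have "[:- [:0, 1:], 1:] dvd p - z_to_y p"
    unfolding poly_eq_0_iff_dvd[symmetric] by (simp add: z_to_y_def)
  then show ?thesis
    by (simp add: Ypoly_def Zpoly_def)
qed

text \<open>
  Both differences in the functional equation are divisible by their denominators as polynomials, so
  the equation computes each coefficient of \<open>S\<close> as a polynomial from the preceding one.
\<close>

definition insertion_step :: "rat poly poly \<Rightarrow> rat poly poly" where
  "insertion_step p = Ypoly * Zpoly *
     ((y_to_1 p - p) div (1 - Ypoly) + (p - z_to_y p) div (Zpoly - Ypoly))"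

lemma insertion_step_eq:
  "(1 - Ypoly) * (Zpoly - Ypoly) * insertion_step p =
     Ypoly * Zpoly * ((Zpoly - Ypoly) * (y_to_1 p - p) + (1 - Ypoly) * (p - z_to_y p))"
proof -
  have 1: "(1 - Ypoly) * ((y_to_1 p - p) div (1 - Ypoly)) = y_to_1 p - p"
    using dvd_y_to_1 by (rule dvd_mult_div_cancel)
  have 2: "(Zpoly - Ypoly) * ((p - z_to_y p) div (Zpoly - Ypoly)) = p - z_to_y p"
    using dvd_z_to_y by (rule dvd_mult_div_cancel)
  have "(1 - Ypoly) * (Zpoly - Ypoly) * insertion_step p =
     Ypoly * Zpoly *
       ((Zpoly - Ypoly) * ((1 - Ypoly) * ((y_to_1 p - p) div (1 - Ypoly))) +
        (1 - Ypoly) * ((Zpoly - Ypoly) * ((p - z_to_y p) div (Zpoly - Ypoly))))"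
    unfolding insertion_step_def by (simp only: distrib_left mult_ac)
  then show ?thesis
    by (simp only: 1 2)
qed

definition S_recurrence :: "rat poly poly fps \<Rightarrow> rat poly poly fps" where
  "S_recurrence S = fps_X * fps_const (Ypoly * Zpoly) +
     fps_X * Abs_fps (\<lambda>n. insertion_step (fps_nth S n))"

interpretation ratfun: rat_hom ratfun2_const
proof
  show "ratfun2_const 1 = 1"
    by (simp add: ratfun2_const_def flip: one_pCons)
  show "ratfun2_const (c + d) = ratfun2_const c + ratfun2_const d" for c d
    by (simp add: ratfun2_const_def flip: to_fract_add)
  show "ratfun2_const (c * d) = ratfun2_const c * ratfun2_const d" for c d
    by (simp add: ratfun2_const_def flip: to_fract_mult)
qed (simp add: ratfun2_const_def)

text \<open>
  The two sides of the equation of \<open>S\<close> are the images of polynomial coefficients under the embedding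
  into the rational functions, which is injective.
\<close>

lemma S_equation_iff_recurrence: "S_equation S \<longleftrightarrow> S = S_recurrence S"
proof -
  have y: "y_var = to_fract Ypoly" and z: "z_var = to_fract Zpoly"
    by (simp_all add: y_var_def z_var_def Ypoly_def Zpoly_def)
  have ev1: "eval2 ratfun2_const 1 z_var p = to_fract (y_to_1 p)" for p
    using ratfun.eval2_y_to_1[of y_var z_var p] by (simp add: eval2_generic)
  have evy: "eval2 ratfun2_const y_var y_var p = to_fract (z_to_y p)" for p
    using ratfun.eval2_z_to_y[of y_var z_var p] by (simp add: eval2_generic)
  have "1 - Ypoly \<noteq> 0" "Zpoly - Ypoly \<noteq> 0"
    by (simp_all add: Ypoly_def Zpoly_def one_pCons)
  then have nz: "to_fract (1 - Ypoly) \<noteq> 0" "to_fract (Zpoly - Ypoly) \<noteq> 0"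
    unfolding to_fract_eq_0_iff .
  have step: "y_var * z_var / (1 - y_var) * (to_fract (y_to_1 p) - to_fract p)
      + y_var * z_var / (z_var - y_var) * (to_fract p - to_fract (z_to_y p))
      = to_fract (insertion_step p)" for p
  proof -
    have divide_both: "s = c / d * p + c / e * q"
      if "d \<noteq> 0" "e \<noteq> 0" "d * e * s = c * (e * p + d * q)" for c d e p q s :: "'a::field"
      using that by (simp add: field_simps)
    have "to_fract (1 - Ypoly) * to_fract (Zpoly - Ypoly) * to_fract (insertion_step p) =
       to_fract Ypoly * to_fract Zpoly * (to_fract (Zpoly - Ypoly) * to_fract (y_to_1 p - p)
         + to_fract (1 - Ypoly) * to_fract (p - z_to_y p))"
      by (simp only: insertion_step_eq flip: to_fract_mult to_fract_add)
    then have "to_fract (insertion_step p) =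
       to_fract Ypoly * to_fract Zpoly / to_fract (1 - Ypoly) * to_fract (y_to_1 p - p)
       + to_fract Ypoly * to_fract Zpoly / to_fract (Zpoly - Ypoly) * to_fract (p - z_to_y p)"
      by (rule divide_both[OF nz])
    then show ?thesis
      by (simp add: y z)
  qed
  have "S_equation S \<longleftrightarrow> (\<forall>n. to_fract (fps_nth S n) = to_fract (fps_nth (S_recurrence S) n))"
    unfolding S_equation_def Let_def fps_eq_iff
  proof (intro iff_allI)
    fix n
    show "(fps_nth (fps_eval2 ratfun2_const S y_var z_var) n =
        fps_nth (fps_X * fps_const (y_var * z_var) +
          fps_X * fps_const (y_var * z_var / (1 - y_var)) *
            (fps_eval2 ratfun2_const S 1 z_var - fps_eval2 ratfun2_const S y_var z_var) +
          fps_X * fps_const (y_var * z_var / (z_var - y_var)) *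
            (fps_eval2 ratfun2_const S y_var z_var - fps_eval2 ratfun2_const S y_var y_var)) n)
      = (to_fract (fps_nth S n) = to_fract (fps_nth (S_recurrence S) n))"
    proof (cases n)
      case (Suc m)
      then show ?thesis
        by (simp add: fps_eval2_def S_recurrence_def eval2_generic ev1 evy mult.assoc
            step[unfolded mult.assoc, symmetric])
          (simp add: y z add.assoc)
    qed (simp add: fps_eval2_def S_recurrence_def eval2_generic mult.assoc)
  qed
  then show ?thesis
    by (simp add: fps_eq_iff)
qed

lemma S_equation_unique_solution: "\<exists>!S. S_equation S"
  unfolding S_equation_iff_recurrence
proof (rule fps_contraction_fixpoint)
  fix f g :: "rat poly poly fps" and n
  assume "\<And>i. i < n \<Longrightarrow> fps_nth f i = fps_nth g i"
  then show "fps_nth (S_recurrence f) n = fps_nth (S_recurrence g) n"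
    by (cases n) (simp_all add: S_recurrence_def)
qed

lemma W_equation_unique_solution: "\<exists>!W. W_equation W"
  unfolding W_equation_def Let_def
proof (rule fps_contraction_fixpoint)
  fix f g :: "laurent fps" and n
  assume *: "\<And>i. i < n \<Longrightarrow> fps_nth f i = fps_nth g i"
  define a where "a = fps_const a_var"
  show "fps_nth (fps_X * fps_const a_bar * (1 + a) * (f + 1 + a) * (f + a)) n
      = fps_nth (fps_X * fps_const a_bar * (1 + a) * (g + 1 + a) * (g + a)) n"
  proof (cases n)
    case (Suc m)
    have "fps_nth (c * (f + 1 + a) * (f + a)) m = fps_nth (c * (g + 1 + a) * (g + a)) m" for c
      using * Suc by (auto simp: fps_mult_nth intro!: sum.cong)
    then show ?thesis
      by (simp add: Suc mult.assoc)
  qed (simp add: mult.assoc)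
qed

section \<open>Substituting power series for the catalytic variables\<close>

text \<open>
  The series \<open>\<Sum>k. x^k g k\<close>, whose terms are themselves power series in \<open>x\<close>: the terms with
  \<open>k > n\<close> do not reach the coefficient of \<open>x^n\<close>.
\<close>

definition xsum :: "(nat \<Rightarrow> 'a::comm_ring_1 fps) \<Rightarrow> 'a fps" where
  "xsum g = Abs_fps (\<lambda>n. fps_nth (\<Sum>k\<le>n. fps_X ^ k * g k) n)"

lemma xsum_nth: "n \<le> N \<Longrightarrow> fps_nth (xsum g) n = fps_nth (\<Sum>k\<le>N. fps_X ^ k * g k) n"
  unfolding xsum_def fps_nth_Abs_fps fps_sum_nth
  by (rule sum.mono_neutral_left) (auto simp: fps_X_power_mult_nth)

lemma xsum_add: "xsum (\<lambda>k. f k + g k) = xsum f + xsum g"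
  by (rule fps_ext) (simp add: xsum_def fps_sum_nth sum.distrib algebra_simps)

lemma xsum_cmult: "xsum (\<lambda>k. c * g k) = c * xsum g"
proof (rule fps_ext)
  fix n
  have "fps_nth (c * xsum g) n = (\<Sum>i=0..n. fps_nth c i * fps_nth (xsum g) (n - i))"
    by (simp add: fps_mult_nth)
  also have "\<dots> = (\<Sum>i=0..n. fps_nth c i * fps_nth (\<Sum>k\<le>n. fps_X ^ k * g k) (n - i))"
    by (simp add: xsum_nth[of _ n])
  also have "\<dots> = fps_nth (c * (\<Sum>k\<le>n. fps_X ^ k * g k)) n"
    by (simp add: fps_mult_nth)
  also have "\<dots> = fps_nth (xsum (\<lambda>k. c * g k)) n"
    by (simp add: xsum_def sum_distrib_left mult.left_commute)
  finally show "fps_nth (xsum (\<lambda>k. c * g k)) n = fps_nth (c * xsum g) n" ..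
qed

lemma xsum_diff: "xsum (\<lambda>k. f k - g k) = xsum f - xsum g"
  using xsum_add[of f "\<lambda>k. (- 1) * g k"] xsum_cmult[of "- 1" g] by simp

lemma xsum_Suc: "xsum g = g 0 + fps_X * xsum (\<lambda>k. g (Suc k))"
proof (rule fps_ext)
  fix n
  show "fps_nth (xsum g) n = fps_nth (g 0 + fps_X * xsum (\<lambda>k. g (Suc k))) n"
  proof (cases n)
    case (Suc m)
    have "(\<Sum>k\<le>n. fps_X ^ k * g k) = g 0 + fps_X * (\<Sum>k\<le>m. fps_X ^ k * g (Suc k))"
      unfolding Suc by (subst sum.atMost_Suc_shift) (simp add: sum_distrib_left mult.assoc)
    then show ?thesis
      by (simp add: xsum_def Suc)
  qed (simp add: xsum_def)
qed

lemma xsum_0 [simp]: "xsum (\<lambda>k. 0) = 0"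
  by (rule fps_ext) (simp add: xsum_def)

lemma xsum_fps_const: "xsum (\<lambda>k. fps_const (g k)) = Abs_fps g"
proof (rule fps_ext)
  fix n
  have "fps_nth (xsum (\<lambda>k. fps_const (g k))) n = (\<Sum>k\<le>n. if k = n then g n else 0)"
    unfolding xsum_def fps_nth_Abs_fps fps_sum_nth
    by (rule sum.cong) (auto simp: fps_X_power_mult_nth)
  then show "fps_nth (xsum (\<lambda>k. fps_const (g k))) n = fps_nth (Abs_fps g) n"
    by simp
qed

text \<open>
  Here \<open>u\<close> and \<open>v\<close> may depend on \<open>x\<close>, as the points at which the kernel vanishes do.
\<close>

definition S_at :: "rat poly poly fps \<Rightarrow> laurent fps \<Rightarrow> laurent fps \<Rightarrow> laurent fps" where
  "S_at S u v = xsum (\<lambda>k. eval2 (\<lambda>c. fps_const (laurent_const c)) u v (fps_nth S k))"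

lemma S_at_const:
  "S_at S (fps_const u) (fps_const v) = fps_eval2 laurent_const S u v"
proof -
  have sum: "fps_const (sum f A) = (\<Sum>i\<in>A. fps_const (f i))"
    for f :: "nat \<Rightarrow> laurent" and A
    by (induction A rule: infinite_finite_induct) (simp_all flip: fps_const_add)
  have "eval2 (\<lambda>c. fps_const (laurent_const c)) (fps_const u) (fps_const v) p
      = fps_const (eval2 laurent_const u v p)" for p
    by (simp add: eval2_def fps_const_power sum flip: fps_const_mult)
  then show ?thesis
    by (simp add: S_at_def xsum_fps_const fps_eval2_def)
qed

interpretation laurent: rat_hom "\<lambda>c. fps_const (laurent_const c)"
  by standard (simp_all add: laurent_const_def mult_single single_add flip: single_one)

text \<open>
  Evaluation at \<open>(u, v)\<close> is a ring homomorphism, so it carries over the recurrence after multiplication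
  by the denominators.  Clearing the denominators is essential: at some of the points used below
  \<open>1 - u\<close> and \<open>v - u\<close> have constant term \<open>0\<close>.
\<close>

lemma S_at_functional_equation:
  assumes "S_equation S"
  shows "(1 - u) * (v - u) * S_at S u v =
    fps_X * u * v * ((1 - u) * (v - u) + (v - u) * (S_at S 1 v - S_at S u v)
      + (1 - u) * (S_at S u v - S_at S u u))"
proof -
  have rec: "S = S_recurrence S"
    using assms by (simp add: S_equation_iff_recurrence)
  have S0: "fps_nth S 0 = 0"
    by (subst rec) (simp add: S_recurrence_def)
  have SSuc: "fps_nth S (Suc k) = (if k = 0 then Ypoly * Zpoly else 0)
      + insertion_step (fps_nth S k)" for k
    by (subst rec) (simp add: S_recurrence_def)
  let ?e = "eval2 (\<lambda>c. fps_const (laurent_const c))"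
  have step: "(1 - u) * (v - u) * ?e u v (insertion_step p) =
      u * v * ((v - u) * (?e 1 v p - ?e u v p) + (1 - u) * (?e u v p - ?e u u p))" for p
    using arg_cong[OF insertion_step_eq[of p], of "?e u v"]
    by (simp add: laurent.eval2_y_to_1 laurent.eval2_z_to_y)
  have init: "xsum (\<lambda>k. ?e u v (if k = 0 then Ypoly * Zpoly else 0)) = u * v"
    by (subst xsum_Suc) simp
  have "S_at S u v = fps_X * xsum (\<lambda>k. ?e u v (fps_nth S (Suc k)))"
    unfolding S_at_def by (subst xsum_Suc) (simp add: S0)
  also have "\<dots> = fps_X * (u * v + xsum (\<lambda>k. ?e u v (insertion_step (fps_nth S k))))"
    unfolding SSuc laurent.eval2_add xsum_add init ..
  finally have S_eq: "S_at S u v = \<dots>" .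
  have "(1 - u) * (v - u) * S_at S u v = fps_X * (u * v * ((1 - u) * (v - u))
      + xsum (\<lambda>k. (1 - u) * (v - u) * ?e u v (insertion_step (fps_nth S k))))"
    unfolding xsum_cmult S_eq by (simp only: distrib_left mult_ac)
  also have "xsum (\<lambda>k. (1 - u) * (v - u) * ?e u v (insertion_step (fps_nth S k))) =
      u * v * ((v - u) * (S_at S 1 v - S_at S u v) + (1 - u) * (S_at S u v - S_at S u u))"
    unfolding step xsum_cmult xsum_add xsum_diff S_at_def ..
  finally show ?thesis
    by (simp only: mult.assoc add.assoc distrib_left[symmetric])
qed

text \<open>
  The kernel method: the unknown \<open>G\<close> enters the equation only with the coefficient
  \<open>(u - 1) (v - u) - x u v (v - 1)\<close>.
\<close>

lemma kernel_cancellation: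
  fixes x u v G T R :: "'r::idom"
  assumes eq: "(1 - u) * (v - u) * G =
      x * u * v * ((1 - u) * (v - u) + (v - u) * (T - G) + (1 - u) * (G - R))"
    and kernel: "(u - 1) * (v - u) = x * u * v * (v - 1)"
    and "x \<noteq> 0" "u \<noteq> 0" "v \<noteq> 0"
  shows "(u - 1) * (v - u) = (v - u) * T + (u - 1) * R"
proof -
  have "x * u * v * ((u - 1) * (v - u) - ((v - u) * T + (u - 1) * R))
    = ((1 - u) * (v - u) * G -
        x * u * v * ((1 - u) * (v - u) + (v - u) * (T - G) + (1 - u) * (G - R)))
      + ((u - 1) * (v - u) - x * u * v * (v - 1)) * G"
    by (simp add: algebra_simps)
  also have "\<dots> = 0"
    using eq kernel by simp
  finally show ?thesis
    using assms(3-5) by simp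
qed

lemma S_at_kernel_zero:
  assumes "S_equation S" and "(u - 1) * (v - u) = fps_X * u * v * (v - 1)"
    and "u \<noteq> 0" "v \<noteq> 0"
  shows "(u - 1) * (v - u) = (v - u) * S_at S 1 v + (u - 1) * S_at S u u"
  using S_at_functional_equation[OF assms(1), of u v] assms(2) fps_X_neq_zero assms(3,4)
  by (rule kernel_cancellation)

section \<open>Elimination along the orbit of the kernel\<close>

text \<open>
  For fixed \<open>v\<close> the two roots \<open>u\<close> of the kernel equation have product \<open>v\<close>; for fixed \<open>u\<close> the two
  roots \<open>v\<close> satisfy \<open>(v - u) (v' - u) = u (u - 1)\<close>.  Starting at \<open>(1 + a, z)\<close>, these rules produce the
  five pairs below, and the last five conclusions are the kernel equation at each of them, with the
  differences \<open>v - u\<close> in simplified form.  The second coordinate \<open>1 + b\<close> of the last pair no longer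
  involves \<open>W\<close>, which is why the orbit is followed exactly that far.
\<close>

lemma kernel_orbit:
  fixes a b x W V U z :: "'r::idom"
  assumes ab: "a * b = 1" and "z \<noteq> 0" and z: "z = 1 + a + W"
    and W: "W = x * b * (1 + a) * z * (a + W)"
    and V: "V = x * b * z * (a + W)"
    and U: "U = x * b^2 * (1 + a) * (a + W)"
  shows "W = (1 + a) * V" and "b * W = U * z"
    and "z - (1 + V) = a * (1 + V)" and "(1 + b * W) - (1 + V) = b * V"
    and "(1 + b * W) - (1 + U) = U * (a + W)"
    and "a * W = x * (1 + a) * z * (z - 1)"
    and "V * (a * (1 + V)) = x * (1 + V) * z * (z - 1)"
    and "V * (b * V) = x * (1 + V) * (1 + b * W) * (b * W)"
    and "U * (U * (a + W)) = x * (1 + U) * (1 + b * W) * (b * W)"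
    and "U * (b - U) = x * (1 + U) * (1 + b) * b"
proof -
  have ab': "a * (b * t) = t" for t
    by (simp add: ab flip: mult.assoc)
  show WV: "W = (1 + a) * V"
    by (rule trans[OF W]) (simp only: V mult_ac)
  have "b * W = b * (x * b * (1 + a) * z * (a + W))"
    by (rule arg_cong[OF W])
  also have "\<dots> = U * z"
    by (simp only: U power2_eq_square mult_ac)
  finally show WU: "b * W = U * z" .
  show "z - (1 + V) = a * (1 + V)"
    by (simp add: z WV algebra_simps)
  show "(1 + b * W) - (1 + V) = b * V"
  proof -
    have "b * W = b * V + a * b * V"
      by (simp add: WV algebra_simps)
    then show ?thesis
      by (simp add: ab)
  qed
  show "(1 + b * W) - (1 + U) = U * (a + W)"
    unfolding WU by (simp add: z algebra_simps)
  have z1: "z - 1 = a + W"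
    by (simp add: z)
  have z_factor: "(1 + a) * (1 + V) = z"
    by (simp add: z WV algebra_simps)
  have bW: "1 + b * W = b * (a + W)"
    by (simp add: ab distrib_left mult.commute[of b a])
  have Uz: "(1 + U) * z = b * (1 + a) * (a + W)"
  proof -
    have "(1 + U) * z = z + b * W"
      by (simp add: WU distrib_right)
    then show ?thesis
      by (simp add: z ab ab' algebra_simps)
  qed
  have aV: "a * V = x * z * (a + W)"
    by (simp add: V ab' mult_ac)
  show "a * W = x * (1 + a) * z * (z - 1)"
    unfolding z1 using arg_cong[OF aV, of "\<lambda>t. (1 + a) * t"] WV
    by (simp only: mult_ac)
  show "V * (a * (1 + V)) = x * (1 + V) * z * (z - 1)"
    unfolding z1 using arg_cong[OF aV, of "\<lambda>t. (1 + V) * t"]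
    by (simp only: mult_ac)
  have "x * (1 + V) * (1 + b * W) * (b * W) = x * b * ((1 + a) * (1 + V)) * (a + W) * (b * V)"
    unfolding bW by (subst (2) WV) (simp only: mult_ac)
  also have "\<dots> = V * (b * V)"
    unfolding z_factor V[symmetric] ..
  finally show "V * (b * V) = x * (1 + V) * (1 + b * W) * (b * W)" ..
  have "x * (1 + U) * (1 + b * W) * (b * W) = x * b * (a + W) * U * ((1 + U) * z)"
    unfolding bW unfolding WU by (simp only: mult_ac)
  also have "\<dots> = (x * b^2 * (1 + a) * (a + W)) * (U * (a + W))"
    unfolding Uz by (simp only: power2_eq_square mult_ac)
  also have "\<dots> = U * (U * (a + W))"
    unfolding U[symmetric] ..
  finally show "U * (U * (a + W)) = x * (1 + U) * (1 + b * W) * (b * W)" ..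
  have b1: "1 + b = b * (1 + a)"
    by (simp add: ab distrib_left mult.commute[of b a])
  have "x * (1 + U) * (1 + b) * b * z = x * b * (b * (1 + a)) * ((1 + U) * z)"
    unfolding b1 by (simp only: mult_ac)
  also have "\<dots> = (x * b^2 * (1 + a) * (a + W)) * (b * (1 + a))"
    unfolding Uz by (simp only: power2_eq_square mult_ac)
  also have "\<dots> = U * (b * (1 + a))"
    unfolding U[symmetric] ..
  also have "b * (1 + a) = (b - U) * z"
    using WU by (simp add: z algebra_simps)
  finally show "U * (b - U) = x * (1 + U) * (1 + b) * b"
    using \<open>z \<noteq> 0\<close> by (simp add: mult.assoc[symmetric])
qed

text \<open>
  The assumptions \<open>E0\<close> to \<open>E4\<close> are the relations at the five pairs, with common factors cancelled; the
  unknowns are eliminated from the end of the chain backwards.  Replacing the product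
  \<open>z (a + W)\<close> by \<open>a W / (x (1 + a))\<close> then allows a factor \<open>W\<close> to be cancelled, which removes \<open>W\<close> from
  the coefficient of \<open>T2\<close> and leaves a polynomial in \<open>W\<close>.
\<close>

lemma orbit_elimination:
  fixes a b x W V U z :: "'r::idom"
  assumes ab: "a * b = 1" and "W \<noteq> 0" and z: "z = 1 + a + W"
    and W: "W = x * b * (1 + a) * z * (a + W)"
    and V: "W = (1 + a) * V"
    and U: "b * W = U * z"
    and E0: "a * W = W * T0 + a * R0"
    and E1: "a * (1 + V) * V = a * (1 + V) * T0 + V * R1"
    and E2: "b * V = b * T1 + R1"
    and E3: "U * (a + W) = (a + W) * T1 + R2"
    and E4: "U * (b - U) = (b - U) * T2 + U * R2"
  shows "R0 = (1 + a)^2 * x + (b^5 + b^4 + 2 + 2 * a) * x * W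
      + (- (b^5) - b^4 + b^3 - b^2 - b + 1) * x * W^2 + (b^4 - b^2) * x * W^3
      - x * (1 + a)^2 * b^4 * T2"
proof -
  have ab': "a * (b * t) = t" for t
    by (simp add: ab flip: mult.assoc)
  have bU: "(b - U) * z = b * (1 + a)"
    using U by (simp add: z algebra_simps)
  have "b * (1 + a) * T2 = z * ((b - U) * T2)"
    using bU by (metis mult.commute mult.left_commute)
  also have "\<dots> = (b - U) * z * U - U * z * R2"
    unfolding left_diff_distrib[of b U z] using arg_cong[OF E4, of "\<lambda>t. z * t"]
    by (simp add: algebra_simps)
  also have "R2 = (a + W) * (U - T1)"
    using E3 by (simp add: algebra_simps)
  finally have "b * (1 + a) * T2 = b * (1 + a) * U - b * W * ((a + W) * (U - T1))"
    unfolding bU U by (simp add: mult.assoc)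
  then have "b * (W * (a + W) * T1) = b * (W * (a + W) * U - U * (1 + a) + (1 + a) * T2)"
    by (simp add: algebra_simps)
  from arg_cong[OF this, of "\<lambda>t. a * t"] have T1: "W * (a + W) * T1 = W * (a + W) * U - U * (1 + a) + (1 + a) * T2"
    unfolding ab' .
  have az: "(1 + a) * (1 + V) = z"
    by (simp add: z V algebra_simps)
  have "a * z * T0 = (1 + a) * (a * (1 + V) * T0)"
    by (simp add: az[symmetric] mult_ac)
  also have "\<dots> = (1 + a) * (a * (1 + V) * V - V * R1)"
    using E1 by simp
  also have "R1 = b * V - b * T1"
    using E2 by simp
  also have "(1 + a) * (a * (1 + V) * V - V * (b * V - b * T1))
      = a * ((1 + a) * (1 + V)) * V - b * V * ((1 + a) * V) + b * ((1 + a) * V) * T1"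
    by (simp add: algebra_simps)
  finally have T0: "a * z * T0 = a * z * V - b * V * W + b * W * T1"
    by (simp only: az V[symmetric])
  have "R0 = a * b * R0"
    by (simp add: ab)
  also have "\<dots> = b * (a * W - W * T0)"
    using E0 by (simp add: algebra_simps)
  finally have "R0 = b * (a * W - W * T0)" .
  from arg_cong[OF this, of "\<lambda>t. a * z * t"]
  have "a * z * R0 = a * b * (a * z * W) - b * W * (a * z * T0)"
    by (simp add: algebra_simps)
  then have "a * z * R0 = a * z * W - z * V * W + b^2 * V * W^2 - b^2 * W^2 * T1"
    unfolding T0 by (simp add: ab ab' algebra_simps power2_eq_square)
  from arg_cong[OF this, of "\<lambda>t. (a + W) * t"]
  have "a * (z * (a + W)) * R0
      = (a + W) * (a * z * W - z * V * W + b^2 * V * W^2) - b^2 * W * (W * (a + W) * T1)"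
    by (simp add: algebra_simps power2_eq_square)
  also have "\<dots> = W * ((a + W) * (a * z - z * V + b^2 * V * W)
      - b^2 * (W * (a + W) * U - U * (1 + a) + (1 + a) * T2))"
    unfolding T1 by (simp add: algebra_simps power2_eq_square)
  finally have main: "a * (z * (a + W)) * R0 = \<dots>" .
  \<comment> \<open>\<open>B\<close> is the cofactor of \<open>W\<close> on the right-hand side of \<open>main\<close>.\<close>
  define B where "B = (a + W) * (a * z - z * V + b^2 * V * W)
      - b^2 * (W * (a + W) * U - U * (1 + a) + (1 + a) * T2)"
  have "a * W = x * (1 + a) * (z * (a + W))"
    using arg_cong[OF W, of "\<lambda>t. a * t"] by (simp only: mult_ac ab')
  then have "W * (a^2 * R0) = x * (1 + a) * (a * (z * (a + W)) * R0)"
    by (simp add: power2_eq_square mult_ac)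
  also have "\<dots> = W * (x * (1 + a) * B)"
    unfolding main B_def by (simp only: mult_ac)
  finally have "a^2 * R0 = x * (1 + a) * B"
    using \<open>W \<noteq> 0\<close> by simp
  then have "b^2 * (a^2 * R0) = b^2 * (x * (1 + a) * B)"
    by simp
  then have R0: "R0 = x * b^2 * ((1 + a) * B)"
    by (simp add: ab ab' power2_eq_square mult_ac)
  \<comment> \<open>\<open>1 + a - W (a + W)\<close> is the multiple \<open>z (1 - W)\<close> of \<open>z\<close>, and \<open>U z = b W\<close>.\<close>
  have U': "U * (1 + a) - W * (a + W) * U = b * W * (1 - W)"
    unfolding U by (simp add: z algebra_simps)
  have "(1 + a) * B = (1 + a) * (a + W) * a * z - (a + W) * z * ((1 + a) * V)
      + b^2 * W * (a + W) * ((1 + a) * V)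
      + (1 + a) * b^2 * (U * (1 + a) - W * (a + W) * U) - (1 + a)^2 * b^2 * T2"
    unfolding B_def by (simp add: algebra_simps power2_eq_square)
  also have "\<dots> = (1 + a) * (a + W) * a * z - (a + W) * z * W
      + b^2 * W * (a + W) * W + (1 + a) * b^2 * (b * W * (1 - W)) - (1 + a)^2 * b^2 * T2"
    by (simp only: U' V[symmetric])
  finally have B: "(1 + a) * B = \<dots>" .
  show ?thesis
    unfolding R0 B z by (simp add: ab ab' algebra_simps eval_nat_numeral)
qed

text \<open>
  The pairs of the orbit have nonzero coordinates because their constant terms in \<open>x\<close> are nonzero, and
  common factors \<open>W\<close>, \<open>V\<close> and \<open>U\<close> cancel because power series over the Laurent polynomials form an
  integral domain.
\<close>

lemma S_at_1_plus_a:
  assumes "W_equation W" and S: "S_equation S"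
  defines "a \<equiv> fps_const a_var" and "b \<equiv> fps_const a_bar"
  shows "S_at S (1 + a) (1 + a) = F_series W - fps_X * (1 + a)^2 * b^4 * S_at S 1 (1 + b)"
proof -
  let ?x = "fps_X :: laurent fps"
  define z where "z = 1 + a + W"
  define V where "V = ?x * b * z * (a + W)"
  define U where "U = ?x * b^2 * (1 + a) * (a + W)"
  have ab: "a * b = 1"
    by (simp add: a_def b_def a_bar_a_var mult.commute)
  have W: "W = ?x * b * (1 + a) * z * (a + W)"
    using assms(1) by (simp add: W_equation_def Let_def a_def b_def z_def add_ac)
  have const0: "fps_nth W 0 = 0" "fps_nth V 0 = 0" "fps_nth U 0 = 0"
    by (subst W, simp add: mult.assoc) (simp_all add: V_def U_def mult.assoc)
  have "poly_mapping.lookup (1 + a_var) 0 \<noteq> 0"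
    by (simp add: lookup_add a_var_def lookup_single lookup_one)
  then have a1: "1 + a_var \<noteq> 0"
    by (metis lookup_zero)
  have a0: "a \<noteq> 0" and b0: "b \<noteq> 0"
    using ab by auto
  have nonzero: "f \<noteq> 0" if "fps_nth f 0 \<noteq> 0" for f :: "laurent fps"
    using that by auto
  have ya: "1 + a \<noteq> 0" and z0: "z \<noteq> 0" and yV: "1 + V \<noteq> 0" and yU: "1 + U \<noteq> 0"
    and zW: "1 + b * W \<noteq> 0"
    by (rule nonzero, simp add: a_def z_def a1 const0)+
  have "a + W \<noteq> 0"
    using a0 by (intro nonzero) (simp add: a_def const0)
  then have V0: "V \<noteq> 0" and U0: "U \<noteq> 0"
    using ya z0 b0 by (simp_all add: V_def U_def)
  note orbit = kernel_orbit[OF ab z0 z_def W V_def U_def]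
  have W0: "W \<noteq> 0"
    using orbit(1) ya V0 by simp
  have "1 + b = b * (1 + a)"
    using ab by (simp add: distrib_left mult.commute)
  then have zb: "1 + b \<noteq> 0"
    using b0 ya by simp
  let ?R = "\<lambda>u. S_at S u u" and ?T = "\<lambda>v. S_at S 1 v"
  have rel: "(u - 1) * (v - u) = (v - u) * ?T v + (u - 1) * ?R u"
    if "(u - 1) * (v - u) = ?x * u * v * (v - 1)" "u \<noteq> 0" "v \<noteq> 0" for u v
    using S that by (rule S_at_kernel_zero)
  have E0: "a * W = W * ?T z + a * ?R (1 + a)"
  proof -
    have "(1 + a) - 1 = a" "z - (1 + a) = W"
      by (simp_all add: z_def)
    with rel[of "1 + a" z] orbit(6) ya z0 show ?thesis
      by simp
  qed
  have E1: "a * (1 + V) * V = a * (1 + V) * ?T z + V * ?R (1 + V)"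
    using rel[of "1 + V" z] orbit(3,7) yV z0 by (simp add: mult.commute[of _ V])
  have "V * (b * V) = b * V * ?T (1 + b * W) + V * ?R (1 + V)"
    using rel[of "1 + V" "1 + b * W", unfolded orbit(4)] orbit(8) yV zW by simp
  then have "V * (b * V) = V * (b * ?T (1 + b * W) + ?R (1 + V))"
    by (simp only: distrib_left[symmetric] mult.assoc mult.left_commute[of b V])
  then have E2: "b * V = b * ?T (1 + b * W) + ?R (1 + V)"
    using V0 by simp
  have "U * (U * (a + W)) = U * (a + W) * ?T (1 + b * W) + U * ?R (1 + U)"
    using rel[of "1 + U" "1 + b * W", unfolded orbit(5)] orbit(9) yU zW by simp
  then have "U * (U * (a + W)) = U * ((a + W) * ?T (1 + b * W) + ?R (1 + U))"
    by (simp only: distrib_left[symmetric] mult.assoc)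
  then have E3: "U * (a + W) = (a + W) * ?T (1 + b * W) + ?R (1 + U)"
    using U0 by simp
  have E4: "U * (b - U) = (b - U) * ?T (1 + b) + U * ?R (1 + U)"
    using rel[of "1 + U" "1 + b"] orbit(10) yU zb by simp
  show ?thesis
    using orbit_elimination[OF ab W0 z_def W orbit(1,2) E0 E1 E2 E3 E4]
    by (simp add: F_series_def Let_def a_def b_def)
qed

section \<open>Extracting the non-negative part\<close>

text \<open>
  Laurent polynomials with exponents in a fixed additive submonoid of the integers form a subring.
\<close>

lemma keys_eval2:
  assumes "0 \<in> M" and add: "\<And>i j. i \<in> M \<Longrightarrow> j \<in> M \<Longrightarrow> i + j \<in> M"
    and u: "Poly_Mapping.keys u \<subseteq> M" and v: "Poly_Mapping.keys v \<subseteq> M"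
  shows "Poly_Mapping.keys (eval2 laurent_const u v p) \<subseteq> M"
proof -
  have mult: "Poly_Mapping.keys (f * g) \<subseteq> M"
    if "Poly_Mapping.keys f \<subseteq> M" "Poly_Mapping.keys g \<subseteq> M" for f g :: laurent
    using keys_mult[of f g] that add by blast
  have power: "Poly_Mapping.keys (f ^ n) \<subseteq> M" if "Poly_Mapping.keys f \<subseteq> M"
    for f :: laurent and n
    by (induction n) (use that \<open>0 \<in> M\<close> mult in \<open>auto simp: keys_one\<close>)
  have sum: "Poly_Mapping.keys (sum f A) \<subseteq> M" if "\<And>x. x \<in> A \<Longrightarrow> Poly_Mapping.keys (f x) \<subseteq> M"
    for f :: "nat \<Rightarrow> laurent" and A
    using keys_sum[of f A] that by blast
  have const: "Poly_Mapping.keys (laurent_const c) \<subseteq> M" for c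
    using \<open>0 \<in> M\<close> by (simp add: laurent_const_def)
  show ?thesis
    unfolding eval2_def by (intro sum mult power const u v)
qed

lemma nonneg_part_add: "nonneg_part (f + g) = nonneg_part f + nonneg_part g"
  by (rule poly_mapping_eqI) (simp add: lookup_nonneg_part lookup_add)

lemma nonneg_part_id:
  assumes "Poly_Mapping.keys f \<subseteq> {0..}"
  shows "nonneg_part f = f"
  using assms by (intro poly_mapping_eqI) (auto simp: lookup_nonneg_part in_keys_iff)

lemma nonneg_part_eq_0:
  assumes "Poly_Mapping.keys f \<subseteq> {..<0}"
  shows "nonneg_part f = 0"
  using assms by (intro poly_mapping_eqI) (auto simp: lookup_nonneg_part in_keys_iff)

lemma Omega_ge_add: "Omega_ge (F + G) = Omega_ge F + Omega_ge G"
  by (rule fps_ext) (simp add: Omega_ge_def nonneg_part_add)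

lemma Omega_ge_S_diagonal:
  "Omega_ge (fps_eval2 laurent_const S (1 + a_var) (1 + a_var))
     = fps_eval2 laurent_const S (1 + a_var) (1 + a_var)"
proof -
  have "Poly_Mapping.keys (1 + a_var) \<subseteq> {0..}"
    using keys_add[of 1 a_var] by (auto simp: a_var_def keys_one)
  then have "Poly_Mapping.keys (eval2 laurent_const (1 + a_var) (1 + a_var) p) \<subseteq> {0..}" for p
    by (intro keys_eval2) auto
  then show ?thesis
    by (intro fps_ext) (simp add: Omega_ge_def fps_eval2_def nonneg_part_id)
qed

text \<open>
  Since \<open>b (1 + a) = 1 + b\<close>, the factor \<open>(1 + a)^2 b^4\<close> is \<open>b^2 (1 + b)^2\<close>, a multiple of \<open>b^2\<close> in the
  polynomials in \<open>b\<close>, and \<open>S(1, 1 + b)\<close> has coefficients that are polynomials in \<open>b\<close>.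
\<close>

lemma Omega_ge_S_boundary:
  "Omega_ge (fps_X * (1 + fps_const a_var)^2 * fps_const a_bar ^ 4
      * fps_eval2 laurent_const S 1 (1 + a_bar)) = 0"
proof -
  define c where "c = (1 + a_var)^2 * a_bar ^ 4"
  have one_plus: "1 + fps_const a_var = fps_const (1 + a_var)"
    by (simp flip: fps_const_add)
  have c: "fps_X * (1 + fps_const a_var)^2 * fps_const a_bar ^ 4 = fps_X * fps_const c"
    by (simp only: one_plus c_def fps_const_power fps_const_mult mult.assoc)
  have "a_bar * (1 + a_var) = 1 + a_bar"
    by (simp add: distrib_left a_bar_a_var)
  moreover have "c = a_bar ^ 2 * (a_bar * (1 + a_var)) * (a_bar * (1 + a_var))"
    by (simp add: c_def eval_nat_numeral mult_ac)
  ultimately have c_eq: "c = a_bar ^ 2 * (1 + a_bar) * (1 + a_bar)"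
    by simp
  have neg_mult: "Poly_Mapping.keys (f * g) \<subseteq> {..<0}"
    if "Poly_Mapping.keys f \<subseteq> {..<0}" "Poly_Mapping.keys g \<subseteq> {..0}" for f g :: laurent
    using keys_mult[of f g] that by fastforce
  have 1: "Poly_Mapping.keys (a_bar ^ 2) \<subseteq> {..<0}"
    by (simp add: a_bar_def power2_eq_square mult_single)
  have 2: "Poly_Mapping.keys (1 + a_bar) \<subseteq> {..0}"
    using keys_add[of 1 a_bar] by (auto simp: a_bar_def keys_one)
  have "nonneg_part (c * eval2 laurent_const 1 (1 + a_bar) p) = 0" for p
  proof -
    have "Poly_Mapping.keys (eval2 laurent_const 1 (1 + a_bar) p) \<subseteq> {..0}"
      using 2 by (intro keys_eval2) (auto simp: keys_one)
    then show ?thesis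
      unfolding c_eq by (intro nonneg_part_eq_0 neg_mult 1 2)
  qed
  moreover have "nonneg_part 0 = 0"
    by (simp add: nonneg_part_def)
  ultimately show ?thesis
    unfolding c
    by (intro fps_ext) (simp add: Omega_ge_def fps_eval2_def mult.assoc)
qed

theorem theorem12:
  shows "(\<exists>!W. W_equation W) \<and> (\<exists>!S. S_equation S) \<and>
    (\<forall>W S. W_equation W \<longrightarrow> S_equation S \<longrightarrow>
       fps_eval2 laurent_const S (1 + a_var) (1 + a_var) = Omega_ge (F_series W))"
proof (intro conjI allI impI)
  show "\<exists>!W. W_equation W"
    by (rule W_equation_unique_solution)
  show "\<exists>!S. S_equation S"
    by (rule S_equation_unique_solution)
next
  fix W S
  assume "W_equation W" "S_equation S"
  define R where "R = fps_eval2 laurent_const S (1 + a_var) (1 + a_var)"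
  define N where "N = fps_X * (1 + fps_const a_var)^2 * fps_const a_bar ^ 4
      * fps_eval2 laurent_const S 1 (1 + a_bar)"
  have R: "S_at S (1 + fps_const a_var) (1 + fps_const a_var) = R"
    using S_at_const[of S "1 + a_var" "1 + a_var"] by (simp add: R_def flip: fps_const_add)
  have T: "S_at S 1 (1 + fps_const a_bar) = fps_eval2 laurent_const S 1 (1 + a_bar)"
    using S_at_const[of S 1 "1 + a_bar"] by (simp flip: fps_const_add)
  have "R = F_series W - N"
    using S_at_1_plus_a[OF \<open>W_equation W\<close> \<open>S_equation S\<close>] unfolding R T N_def .
  then have "F_series W = R + N"
    by simp
  then have "Omega_ge (F_series W) = R"
    unfolding R_def N_def
    by (simp only: Omega_ge_add Omega_ge_S_diagonal Omega_ge_S_boundary add_0_right)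
  then show "fps_eval2 laurent_const S (1 + a_var) (1 + a_var) = Omega_ge (F_series W)"
    by (simp add: R_def)
qed

end
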